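(* Let $d\geq1$ be an integer, $\mathbf{m}=(m_1,\ldots,m_d)\in\mathbb{Z}_{>0}^d$, $\bm{\beta}=(\beta_1,\ldots,\beta_d)\in\mathbb{R}^d$, $G_{\mathbf{m}}=\mathbb{Z}^d/\mathbf{m}\mathbb{Z}^d$ and $M=\prod_{j=1}^d m_j$. Let $S$ be a finite symmetric subset of $\mathbb{Z}^d$ with a probability distribution $\pi_S$ satisfying $\pi_S(s)=\pi_S(-s)>0$ for all $s\in S$. For $\mathbf{n}=(n_1,\ldots,n_d)$ with $n_j\in\{0,\ldots,m_j-1\}$ define $$\chi_{\mathbf{n}}^{\mathbf{m},\bm{\beta}}(\mathbf{x})=\prod_{j=1}^d\exp\left(2\pi i\frac{n_j+\beta_j}{m_j}x_j\right)\quad(\mathbf{x}\in\mathbb{Z}^d),\qquad \lambda_{\mathbf{n}}^{\mathbf{m},\bm{\beta}}=\sum_{s\in S}\pi_S(s)\chi_{\mathbf{n}}^{\mathbf{m},\bm{\beta}}(s).$$ Then for every positive integer $n$ and all $\mathbf{x},\mathbf{y}\in\mathbb{Z}^d$, $$\sum_{\mathbf{k}\in\mathbb{Z}^d}\exp(-2\pi i\,\mathbf{k}\cdot\bm{\beta})\,K_Y(\mathbf{x}-\mathbf{y}+\mathbf{k}\mathbf{m},\mathbf{0};n)=\frac{1}{M}\sum_{\mathbf{n}\in G_{\mathbf{m}}}\left(\lambda_{\mathbf{n}}^{\mathbf{m},\bm{\beta}}\right)^n\chi_{\mathbf{n}}^{\mathbf{m},\bm{\beta}}(\mathbf{x})\overline{\chi_{\mathbf{n}}^{\mathbf{m},\bm{\beta}}(\mathbf{y})},$$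 where the sum over $\mathbf{n}\in G_{\mathbf{m}}$ runs over $n_j\in\{0,\ldots,m_j-1\}$, $j=1,\ldots,d$.
   Context: Notation: $\mathbf{k}\mathbf{m}=(k_1m_1,\ldots,k_dm_d)$, $\mathbf{k}\cdot\bm{\beta}=\sum_jk_j\beta_j$. $K_Y(\mathbf{z},\mathbf{0};n)$ is the discrete time heat kernel of the weighted Cayley graph $\mathcal{C}(\mathbb{Z}^d,S,\pi_S)$, i.e. the probability that the random walk on $\mathbb{Z}^d$ starting at $\mathbf{0}$, which at each step moves by $s\in S$ with probability $\pi_S(s)$, is at $\mathbf{z}$ after $n$ steps; equivalently, $K_Y(\mathbf{z},\mathbf{0};n)$ is the coefficient of $t_1^{z_1}\cdots t_d^{z_d}$ in the Laurent polynomial $\left(\sum_{s\in S}\pi_S(s)t_1^{s_1}\cdots t_d^{s_d}\right)^n$. Only finitely many terms of the left-hand sum are nonzero. *)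

theory Defs
  imports "HOL-Probability.Probability"
begin

text \<open>
  A weighted Cayley graph of \<open>\<int>\<^sup>d\<close> is given by its step distribution \<open>\<pi>\<close>, a probability mass
  function on \<open>int ^ 'd\<close> supported on the connection set \<open>S\<close>; here \<open>d = CARD('d) \<ge> 1\<close>.
\<close>

primrec random_walk :: "'a::ab_group_add pmf \<Rightarrow> 'a \<Rightarrow> nat \<Rightarrow> 'a pmf" where
  "random_walk \<pi> y 0 = return_pmf y"
| "random_walk \<pi> y (Suc n) = bind_pmf (random_walk \<pi> y n) (\<lambda>x. map_pmf (\<lambda>s. x + s) \<pi>)"

definition heat_kernel :: "'a::ab_group_add pmf \<Rightarrow> 'a \<Rightarrow> 'a \<Rightarrow> nat \<Rightarrow> real" where
  "heat_kernel \<pi> z y n = pmf (random_walk \<pi> y n) z"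

text \<open>
  The standard representatives, with \<open>0 \<le> n\<^sub>j < m\<^sub>j\<close>, of the classes of \<open>\<int>\<^sup>d / m\<int>\<^sup>d\<close>.
\<close>

definition residue_box :: "int ^ 'd \<Rightarrow> (int ^ 'd) set" where
  "residue_box m = {n. \<forall>j. 0 \<le> n $ j \<and> n $ j < m $ j}"

definition twisted_char ::
    "int ^ 'd \<Rightarrow> real ^ 'd \<Rightarrow> int ^ 'd \<Rightarrow> int ^ 'd \<Rightarrow> complex" where
  "twisted_char m \<beta> n x =
     (\<Prod>j\<in>UNIV. exp (2 * of_real pi * \<i> *
        of_real ((of_int (n $ j) + \<beta> $ j) / of_int (m $ j)) * of_int (x $ j)))"

definition twisted_eigenvalue ::
    "(int ^ 'd) set \<Rightarrow> (int ^ 'd) pmf \<Rightarrow> int ^ 'd \<Rightarrow> real ^ 'd \<Rightarrow> int ^ 'd \<Rightarrow> complex" where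
  "twisted_eigenvalue S \<pi> m \<beta> n = (\<Sum>s\<in>S. of_real (pmf \<pi> s) * twisted_char m \<beta> n s)"

end

theory Submission
  imports Defs
begin

text \<open>
  Writing \<open>z\<close> for the position of the walk after \<open>n\<close> steps, multiplicativity of a character
  turns \<open>\<lambda>\<^sub>\<nu>\<^sup>n\<close> into the expectation of \<open>\<chi>\<^sub>\<nu>(-z)\<close>; the sign comes for free from the symmetry of
  the step distribution. Averaging \<open>\<chi>\<^sub>\<nu>(x - y - z)\<close> over \<open>\<nu>\<close> annihilates every \<open>z\<close> outside
  \<open>x - y + m\<int>\<^sup>d\<close> and leaves the phase \<open>exp(-2\<pi>i k\<cdot>\<beta>)\<close> at \<open>z = x - y + km\<close>.
\<close>

lemma finite_set_pmf_random_walk: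
  assumes "finite (set_pmf \<pi>)"
  shows "finite (set_pmf (random_walk \<pi> y n))"
  by (induction n) (use assms in auto)

text \<open>Each step is drawn independently of the current position, and \<open>\<psi>\<close>
  turns adding it into multiplying by a factor, so every step contributes one factor
  \<open>measure_pmf.expectation \<pi> \<psi>\<close>. Finite support turns the expectations into
  finite sums.\<close>

lemma expectation_random_walk_character:
  fixes \<psi> :: "'a::ab_group_add \<Rightarrow> complex"
  assumes fin: "finite (set_pmf \<pi>)"
    and mult: "\<And>a b. \<psi> (a + b) = \<psi> a * \<psi> b"
  shows "measure_pmf.expectation (random_walk \<pi> y n) \<psi>
           = \<psi> y * measure_pmf.expectation \<pi> \<psi> ^ n"
proof (induction n)
  case 0
  show ?case by simp
next
  case (Suc n)
  let ?A = "set_pmf (random_walk \<pi> y n)"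
  have finA: "finite ?A"
    by (rule finite_set_pmf_random_walk[OF fin])
  have "measure_pmf.expectation (random_walk \<pi> y (Suc n)) \<psi> =
        (\<Sum>a\<in>?A. pmf (random_walk \<pi> y n) a *\<^sub>R
           measure_pmf.expectation (map_pmf (\<lambda>s. a + s) \<pi>) \<psi>)"
    unfolding random_walk.simps by (rule pmf_expectation_bind[OF finA]) (use fin in auto)
  also have "\<dots> = (\<Sum>a\<in>?A. pmf (random_walk \<pi> y n) a *\<^sub>R \<psi> a) * measure_pmf.expectation \<pi> \<psi>"
    by (simp add: mult sum_distrib_right)
  also have "(\<Sum>a\<in>?A. pmf (random_walk \<pi> y n) a *\<^sub>R \<psi> a)
               = measure_pmf.expectation (random_walk \<pi> y n) \<psi>"
    by (rule integral_measure_pmf[OF finA, symmetric]) auto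
  finally show ?case
    by (simp add: Suc.IH)
qed

lemma twisted_char_add:
  "twisted_char m \<beta> \<nu> (a + b) = twisted_char m \<beta> \<nu> a * twisted_char m \<beta> \<nu> b"
  by (simp only: twisted_char_def vector_add_component of_int_add ring_distribs(1)
      exp_add prod.distrib)

lemma cnj_twisted_char: "cnj (twisted_char m \<beta> \<nu> a) = twisted_char m \<beta> \<nu> (- a)"
  by (simp add: twisted_char_def exp_cnj)

text \<open>The shift by \<open>\<beta>\<close> only pulls out a factor \<open>c\<close> independent
  of \<open>t\<close>. What remains is a geometric sum of \<open>q\<close>, an \<open>m\<close>-th
  root of unity that equals 1 exactly when \<open>m\<close> divides \<open>w\<close>; in that case
  \<open>c\<close> is the phase in the result.\<close>

lemma sum_twisted_exp:
  fixes m w :: int and \<beta> :: real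
  assumes "m > 0"
  shows "(\<Sum>t\<in>{0..<m}. exp (2 * of_real pi * \<i> *
            of_real ((of_int t + \<beta>) / of_int m) * of_int w) :: complex) =
         (if m dvd w then of_int m * exp (2 * of_real pi * \<i> * of_real (of_int (w div m) * \<beta>))
          else 0)"
proof -
  define q :: complex where "q = exp (2 * of_real pi * \<i> * of_int w / of_int m)"
  define c :: complex where
    "c = exp (2 * of_real pi * \<i> * of_real \<beta> * of_int w / of_int m)"
  have m0: "(of_int m :: complex) \<noteq> 0" using assms by simp
  have exp_int: "exp (2 * of_real pi * \<i> * of_int k) = (1 :: complex)" for k
    using exp_integer_2pi[of "of_int k"] by (simp add: mult_ac)
  have "{0..<m} = int ` {..<nat m}"
    using assms by (simp add: lessThan_atLeast0 image_int_atLeastLessThan)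
  hence "(\<Sum>t\<in>{0..<m}. exp (2 * of_real pi * \<i> *
            of_real ((of_int t + \<beta>) / of_int m) * of_int w) :: complex)
       = (\<Sum>t<nat m. exp (2 * of_real pi * \<i> *
            of_real ((of_nat t + \<beta>) / of_int m) * of_int w))"
    by (simp add: sum.reindex)
  also have "\<dots> = (\<Sum>t<nat m. c * q ^ t)"
  proof (rule sum.cong[OF refl])
    fix t :: nat
    show "exp (2 * of_real pi * \<i> * of_real ((of_nat t + \<beta>) / of_int m) * of_int w) = c * q ^ t"
      by (simp add: q_def c_def flip: exp_of_nat_mult exp_add)
         (simp add: add_divide_distrib algebra_simps)
  qed
  also have "\<dots> = c * (\<Sum>t<nat m. q ^ t)"
    by (simp add: sum_distrib_left)
  also have "\<dots> = (if m dvd w then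
      of_int m * exp (2 * of_real pi * \<i> * of_real (of_int (w div m) * \<beta>)) else 0)"
  proof (cases "m dvd w")
    case True
    then obtain l where l: "w = m * l" by blast
    have "q = 1"
      using exp_int[of l] m0 by (simp add: q_def l mult.assoc)
    moreover have "c = exp (2 * of_real pi * \<i> * of_real (of_int (w div m) * \<beta>))"
      using m0 assms by (simp add: c_def l mult_ac)
    ultimately show ?thesis
      using True assms by simp
  next
    case False
    \<comment> \<open>If \<open>q = 1\<close>, its exponent is an integer multiple of
      \<open>2 * pi * \<i>\<close>; comparing imaginary parts gives
      \<open>w = k * m\<close>.\<close>
    have "q \<noteq> 1"
    proof
      assume "q = 1"
      then obtain k :: int where "Im (2 * of_real pi * \<i> * of_int w / of_int m) = of_int (2 * k) * pi"
        unfolding q_def exp_eq_1 by blast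
      hence "real_of_int w = of_int (k * m)"
        using assms by (simp add: field_simps)
      hence "w = k * m" by (simp only: of_int_eq_iff)
      with False show False by simp
    qed
    \<comment> \<open>This is the numerator in the closed form of the geometric sum, so the sum
      vanishes.\<close>
    moreover have "q ^ nat m = 1"
      using exp_int[of w] m0 assms by (simp add: q_def flip: exp_of_nat_mult)
    ultimately show ?thesis
      using False by (simp add: sum_gp_strict)
  qed
  finally show ?thesis .
qed

text \<open>Puts the box into the function-space form in which a sum of products factors by
  \<open>prod_sum_PiE\<close>.\<close>

lemma bij_betw_residue_box:
  "bij_betw vec_lambda (PiE UNIV (\<lambda>j. {0..<m $ j})) (residue_box m)"
  by (rule bij_betwI[where g = vec_nth]) (auto simp: residue_box_def)

text \<open>The character is a product over coordinates, so the sum over the box factors into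
  one-dimensional sums. A single coordinate without divisibility makes the whole product zero;
  otherwise the phases multiply into one exponential.\<close>

lemma sum_twisted_char:
  assumes "\<And>j. m $ j > 0"
  shows "(\<Sum>\<nu>\<in>residue_box m. twisted_char m \<beta> \<nu> w) =
    (if \<forall>j. m $ j dvd w $ j
     then of_int (\<Prod>j\<in>UNIV. m $ j) *
       exp (2 * of_real pi * \<i> * of_real (\<Sum>j\<in>UNIV. of_int (w $ j div m $ j) * \<beta> $ j))
     else 0)"
proof -
  let ?e = "\<lambda>j t. exp (2 * of_real pi * \<i> *
        of_real ((of_int t + \<beta> $ j) / of_int (m $ j)) * of_int (w $ j)) :: complex"
  have "(\<Sum>\<nu>\<in>residue_box m. twisted_char m \<beta> \<nu> w) =
        (\<Sum>g\<in>PiE UNIV (\<lambda>j. {0..<m $ j}). \<Prod>j\<in>UNIV. ?e j (g j))"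
    unfolding twisted_char_def
    by (subst sum.reindex_bij_betw[OF bij_betw_residue_box, symmetric]) simp
  also have "\<dots> = (\<Prod>j\<in>UNIV. \<Sum>t\<in>{0..<m $ j}. ?e j t)"
    by (rule prod_sum_PiE[symmetric]) auto
  also have "\<dots> = (\<Prod>j\<in>UNIV. if m $ j dvd w $ j
      then of_int (m $ j) * exp (2 * of_real pi * \<i> * of_real (of_int (w $ j div m $ j) * \<beta> $ j))
      else 0)"
    by (intro prod.cong refl sum_twisted_exp assms)
  also have "\<dots> = (if \<forall>j. m $ j dvd w $ j
     then of_int (\<Prod>j\<in>UNIV. m $ j) *
       exp (2 * of_real pi * \<i> * of_real (\<Sum>j\<in>UNIV. of_int (w $ j div m $ j) * \<beta> $ j))
     else 0)"
  proof (cases "\<forall>j. m $ j dvd w $ j")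
    case True
    then show ?thesis
      by (simp add: prod.distrib sum_distrib_left exp_sum)
  next
    case False
    then show ?thesis
      by (auto intro!: prod_zero)
  qed
  finally show ?thesis .
qed

text \<open>Reflecting \<open>s\<close> to \<open>- s\<close> preserves both \<open>S\<close> and
  the weights. The reflected form is the one that later combines with \<open>x - y\<close> into
  \<open>x - y - z\<close>.\<close>

lemma twisted_eigenvalue_eq_expectation:
  assumes "finite S" "set_pmf \<pi> \<subseteq> S"
    and sym: "\<And>s. s \<in> S \<Longrightarrow> - s \<in> S" "\<And>s. s \<in> S \<Longrightarrow> pmf \<pi> s = pmf \<pi> (- s)"
  shows "twisted_eigenvalue S \<pi> m \<beta> \<nu> =
    measure_pmf.expectation \<pi> (\<lambda>s. twisted_char m \<beta> \<nu> (- s))"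
proof -
  have "twisted_eigenvalue S \<pi> m \<beta> \<nu> = (\<Sum>s\<in>S. pmf \<pi> s *\<^sub>R twisted_char m \<beta> \<nu> (- s))"
    unfolding twisted_eigenvalue_def
    by (rule sum.reindex_bij_witness[where i = uminus and j = uminus])
       (auto simp: scaleR_conv_of_real sym(1) sym(2)[symmetric])
  also have "\<dots> = measure_pmf.expectation \<pi> (\<lambda>s. twisted_char m \<beta> \<nu> (- s))"
    by (rule integral_measure_pmf[symmetric]) (use assms(1,2) in auto)
  finally show ?thesis .
qed

theorem theorem4p1:
  fixes m :: "int ^ 'd" and \<beta> :: "real ^ 'd"
    and S :: "(int ^ 'd) set" and \<pi> :: "(int ^ 'd) pmf"
    and n :: nat and x y :: "int ^ 'd"
  assumes m_pos: "\<And>j. m $ j > 0"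
    and S_fin: "finite S"
    and S_sym: "\<And>s. s \<in> S \<Longrightarrow> - s \<in> S"
    and pi_on_S: "set_pmf \<pi> \<subseteq> S"
    and pi_sym: "\<And>s. s \<in> S \<Longrightarrow> pmf \<pi> s = pmf \<pi> (- s)"
    and pi_pos: "\<And>s. s \<in> S \<Longrightarrow> pmf \<pi> s > 0"
    and n_pos: "n > 0"
  shows "((\<lambda>k :: int ^ 'd.
            exp (- 2 * of_real pi * \<i> * of_real (\<Sum>j\<in>UNIV. of_int (k $ j) * \<beta> $ j)) *
            of_real (heat_kernel \<pi> (x - y + (\<chi> j. k $ j * m $ j)) 0 n))
          has_sum
          (1 / of_int (\<Prod>j\<in>UNIV. m $ j) *
            (\<Sum>\<nu>\<in>residue_box m.
               twisted_eigenvalue S \<pi> m \<beta> \<nu> ^ n *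
               twisted_char m \<beta> \<nu> x * cnj (twisted_char m \<beta> \<nu> y)))) UNIV"
proof -
  define W where "W = random_walk \<pi> 0 n"
  define g where "g = (\<lambda>k :: int ^ 'd. x - y + (\<chi> j. k $ j * m $ j))"
  define e :: "int ^ 'd \<Rightarrow> complex" where
    "e = (\<lambda>k. exp (- 2 * of_real pi * \<i> * of_real (\<Sum>j\<in>UNIV. of_int (k $ j) * \<beta> $ j)))"
  define P :: complex where "P = of_int (\<Prod>j\<in>UNIV. m $ j)"
  \<comment> \<open>The indices whose shifted point is reachable in \<open>n\<close> steps: outside
    \<open>K\<close> the terms of the series vanish. It is finite because \<open>g\<close> is
    injective, no \<open>m $ j\<close> being zero.\<close>
  define K where "K = g -` set_pmf W"
  have m0: "m $ j \<noteq> 0" for j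
    using m_pos[of j] by simp
  have P0: "P \<noteq> 0"
    using m0 by (simp add: P_def)
  have inj_g: "inj g"
    using m0 by (auto simp: inj_def g_def vec_eq_iff)
  have fin_pi: "finite (set_pmf \<pi>)"
    using pi_on_S S_fin by (rule finite_subset)
  have finW: "finite (set_pmf W)"
    unfolding W_def using fin_pi by (rule finite_set_pmf_random_walk)
  have finK: "finite K"
    unfolding K_def using finW inj_g by (rule finite_vimageI)

  have power: "twisted_eigenvalue S \<pi> m \<beta> \<nu> ^ n =
      (\<Sum>z\<in>set_pmf W. of_real (pmf W z) * twisted_char m \<beta> \<nu> (- z))" for \<nu>
  proof -
    \<comment> \<open>The map sending \<open>z\<close> to the character at \<open>- z\<close> is
      again multiplicative, and the starting point 0 contributes the factor 1.\<close>
    have "measure_pmf.expectation W (\<lambda>z. twisted_char m \<beta> \<nu> (- z)) =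
        twisted_char m \<beta> \<nu> (- 0) *
          measure_pmf.expectation \<pi> (\<lambda>s. twisted_char m \<beta> \<nu> (- s)) ^ n"
      unfolding W_def
      by (rule expectation_random_walk_character[OF fin_pi])
         (simp only: minus_add_distrib twisted_char_add)
    moreover have "twisted_char m \<beta> \<nu> (- 0) = 1"
      by (simp add: twisted_char_def)
    moreover have "measure_pmf.expectation W (\<lambda>z. twisted_char m \<beta> \<nu> (- z)) =
        (\<Sum>z\<in>set_pmf W. pmf W z *\<^sub>R twisted_char m \<beta> \<nu> (- z))"
      by (rule integral_measure_pmf[OF finW]) auto
    ultimately show ?thesis
      using twisted_eigenvalue_eq_expectation[OF S_fin pi_on_S S_sym pi_sym]
      by (simp add: scaleR_conv_of_real)
  qed

  have orth_on: "(\<Sum>\<nu>\<in>residue_box m. twisted_char m \<beta> \<nu> (x - y - g k)) = P * e k" for k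
  proof -
    \<comment> \<open>The coordinatewise quotient by \<open>m\<close> is \<open>- k\<close>, which
      is the source of the minus sign in the phase \<open>e k\<close>.\<close>
    have "x - y - g k = (\<chi> j. m $ j * - k $ j)"
      by (simp add: g_def vec_eq_iff mult.commute)
    moreover have "- (m $ j * k $ j) div m $ j = - k $ j" for j
      by (metis m0 mult_minus_right nonzero_mult_div_cancel_left)
    ultimately show ?thesis
      by (simp add: sum_twisted_char[OF m_pos] P_def e_def sum_negf)
  qed
  have orth_off: "(\<Sum>\<nu>\<in>residue_box m. twisted_char m \<beta> \<nu> (x - y - z)) = 0" if "z \<notin> range g" for z
  proof -
    have "\<not> (\<forall>j. m $ j dvd (x - y - z) $ j)"
    proof
      assume *: "\<forall>j. m $ j dvd (x - y - z) $ j"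
      have "(x - y - z) $ j div m $ j * m $ j = (x - y - z) $ j" for j
        using * by (metis dvd_div_mult_self)
      \<comment> \<open>The witness solves \<open>z = x - y + km\<close> for \<open>k\<close>
        coordinate by coordinate; the divisions are exact.\<close>
      hence "z = g (\<chi> j. - ((x - y - z) $ j div m $ j))"
        by (simp add: g_def vec_eq_iff)
      with that show False by blast
    qed
    then show ?thesis
      unfolding sum_twisted_char[OF m_pos] by (rule if_not_P)
  qed

  have "(\<Sum>\<nu>\<in>residue_box m. twisted_eigenvalue S \<pi> m \<beta> \<nu> ^ n *
               twisted_char m \<beta> \<nu> x * cnj (twisted_char m \<beta> \<nu> y)) =
        (\<Sum>\<nu>\<in>residue_box m. \<Sum>z\<in>set_pmf W.
           of_real (pmf W z) * twisted_char m \<beta> \<nu> (x - y - z))"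
  proof (rule sum.cong[OF refl])
    fix \<nu>
    have "twisted_char m \<beta> \<nu> (x - y - z) =
        twisted_char m \<beta> \<nu> (- z) * twisted_char m \<beta> \<nu> x * cnj (twisted_char m \<beta> \<nu> y)" for z
      by (simp add: cnj_twisted_char algebra_simps flip: twisted_char_add)
    then show "twisted_eigenvalue S \<pi> m \<beta> \<nu> ^ n *
               twisted_char m \<beta> \<nu> x * cnj (twisted_char m \<beta> \<nu> y) =
        (\<Sum>z\<in>set_pmf W. of_real (pmf W z) * twisted_char m \<beta> \<nu> (x - y - z))"
      by (simp add: power sum_distrib_right mult.assoc)
  qed
  also have "\<dots> = (\<Sum>z\<in>set_pmf W. of_real (pmf W z) *
      (\<Sum>\<nu>\<in>residue_box m. twisted_char m \<beta> \<nu> (x - y - z)))"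
    by (subst sum.swap) (simp add: sum_distrib_left)
  \<comment> \<open>The image of \<open>K\<close> is the part of the support of \<open>W\<close>
    inside the range of \<open>g\<close>; the other endpoints drop out by
    \<open>orth_off\<close>.\<close>
  also have "\<dots> = (\<Sum>z\<in>g ` K. of_real (pmf W z) *
      (\<Sum>\<nu>\<in>residue_box m. twisted_char m \<beta> \<nu> (x - y - z)))"
    by (rule sum.mono_neutral_right[OF finW]) (auto simp: K_def orth_off)
  also have "\<dots> = P * (\<Sum>k\<in>K. e k * of_real (pmf W (g k)))"
    by (subst sum.reindex[OF inj_on_subset[OF inj_g subset_UNIV]])
       (simp add: orth_on sum_distrib_left[of P] mult_ac)
  finally have rhs: "1 / P * (\<Sum>\<nu>\<in>residue_box m. twisted_eigenvalue S \<pi> m \<beta> \<nu> ^ n *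
               twisted_char m \<beta> \<nu> x * cnj (twisted_char m \<beta> \<nu> y)) =
      (\<Sum>k\<in>K. e k * of_real (pmf W (g k)))"
    using P0 by simp

  \<comment> \<open>Outside \<open>K\<close> the heat kernel is zero, so the series over all
    \<open>k\<close> reduces to the finite sum just computed.\<close>
  have "((\<lambda>k. e k * of_real (pmf W (g k))) has_sum (\<Sum>k\<in>K. e k * of_real (pmf W (g k)))) UNIV"
    using has_sum_finite[OF finK]
    by (rule has_sum_cong_neutral[THEN iffD1, rotated -1]) (auto simp: K_def set_pmf_iff)
  then show ?thesis
    unfolding rhs[symmetric] unfolding e_def P_def W_def g_def heat_kernel_def .
qed

end
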